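(* There exist a function $f\in C^{1,1}(\mathbb{R})$ with $L_f:=\|f'\|_\infty<\infty$ and $f'$ globally Lipschitz, a constant $L>L_f$, and a number $\delta>0$ such that the function $$u(x,d):=\sup_{y\in\mathbb{R}}\left[f(y)-L\sqrt{(x-y)^2+d^2}\right]$$ is $\infty$-harmonic in the strip $\{(x,d)\in\mathbb{R}^2: 0<d<\delta\}$, and there is a dense subset of this strip at each point of which $u$ is not twice differentiable (so that $u$ is not $C^2$ on a dense subset).
   Context: A continuous function $u$ on an open set $\Omega\subset\mathbb{R}^2$ is called $\infty$-harmonic if it is a viscosity solution in $\Omega$ of the infinity-Laplace equation $\Delta_\infty u=\sum_{i,j}u_{x_i}u_{x_j}u_{x_ix_j}=0$ (equivalently, $u$ is an absolutely minimizing Lipschitz function in $\Omega$). A function is twice differentiable at a point $p$ if it is differentiable in a neighbourhood of $p$ and its gradient is differentiable at $p$. *)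

theory Defs
  imports "HOL-Analysis.Analysis"
begin

definition partial_deriv :: "'a::euclidean_space \<Rightarrow> ('a \<Rightarrow> real) \<Rightarrow> 'a \<Rightarrow> real" where
  "partial_deriv i u p = frechet_derivative u (at p) i"

definition grad :: "('a::euclidean_space \<Rightarrow> real) \<Rightarrow> 'a \<Rightarrow> 'a" where
  "grad u p = (\<Sum>i\<in>Basis. partial_deriv i u p *\<^sub>R i)"

text \<open>Meant for open \<open>\<Omega>\<close>. Continuity of \<open>\<phi>\<close> and of its first partial derivatives
  follows from their differentiability.\<close>

definition C2_on :: "'a::euclidean_space set \<Rightarrow> ('a \<Rightarrow> real) \<Rightarrow> bool" where
  "C2_on \<Omega> \<phi> \<longleftrightarrow>
     (\<forall>p\<in>\<Omega>. \<phi> differentiable (at p)) \<and>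
     (\<forall>i\<in>Basis. \<forall>p\<in>\<Omega>. partial_deriv i \<phi> differentiable (at p)) \<and>
     (\<forall>i\<in>Basis. \<forall>j\<in>Basis. continuous_on \<Omega> (partial_deriv j (partial_deriv i \<phi>)))"

definition infinity_laplacian :: "('a::euclidean_space \<Rightarrow> real) \<Rightarrow> 'a \<Rightarrow> real" where
  "infinity_laplacian \<phi> p =
     (\<Sum>i\<in>Basis. \<Sum>j\<in>Basis.
        partial_deriv i \<phi> p * partial_deriv j \<phi> p * partial_deriv j (partial_deriv i \<phi>) p)"

text \<open>Viscosity solutions of \<open>\<Delta>\<^sub>\<infinity> u = 0\<close>: a \<open>C\<^sup>2\<close> test function touching \<open>u\<close> from above
  (a local maximum of \<open>u - \<phi>\<close>) satisfies \<open>\<Delta>\<^sub>\<infinity> \<phi> \<ge> 0\<close> at the contact point, and one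
  touching from below satisfies \<open>\<Delta>\<^sub>\<infinity> \<phi> \<le> 0\<close>.\<close>

definition infinity_harmonic_on :: "'a::euclidean_space set \<Rightarrow> ('a \<Rightarrow> real) \<Rightarrow> bool" where
  "infinity_harmonic_on \<Omega> u \<longleftrightarrow>
     open \<Omega> \<and> continuous_on \<Omega> u \<and>
     (\<forall>\<phi> p. C2_on \<Omega> \<phi> \<and> p \<in> \<Omega> \<and> (\<forall>\<^sub>F q in nhds p. u q - \<phi> q \<le> u p - \<phi> p)
        \<longrightarrow> infinity_laplacian \<phi> p \<ge> 0) \<and>
     (\<forall>\<phi> p. C2_on \<Omega> \<phi> \<and> p \<in> \<Omega> \<and> (\<forall>\<^sub>F q in nhds p. u q - \<phi> q \<ge> u p - \<phi> p)
        \<longrightarrow> infinity_laplacian \<phi> p \<le> 0)"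

definition twice_differentiable_at :: "('a::euclidean_space \<Rightarrow> real) \<Rightarrow> 'a \<Rightarrow> bool" where
  "twice_differentiable_at u p \<longleftrightarrow>
     (\<forall>\<^sub>F q in nhds p. u differentiable (at q)) \<and> grad u differentiable (at p)"

text \<open>No boundedness of \<open>f\<close> or of \<open>f'\<close> is included.\<close>

definition C11 :: "(real \<Rightarrow> real) \<Rightarrow> bool" where
  "C11 f \<longleftrightarrow>
     (\<forall>y. f differentiable (at y)) \<and> (\<exists>K. K-lipschitz_on UNIV (deriv f))"

text \<open>The plane is \<open>real \<times> real\<close>, whose norm is Euclidean. The supremum is a supremum of
  reals; the set is bounded above whenever \<open>L\<close> exceeds a Lipschitz constant of \<open>f\<close>.\<close>

definition cone_sup :: "(real \<Rightarrow> real) \<Rightarrow> real \<Rightarrow> real \<times> real \<Rightarrow> real" where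
  "cone_sup f L = (\<lambda>(x, d). SUP y. f y - L * sqrt ((x - y)\<^sup>2 + d\<^sup>2))"

definition strip :: "real \<Rightarrow> (real \<times> real) set" where
  "strip \<delta> = {(x, d). 0 < d \<and> d < \<delta>}"

end

theory Submission
  imports Defs
begin

text \<open>
  Take \<open>L = 1\<close>. Where the supremum defining \<open>u\<close> is attained at a foot \<open>y\<close>, the first-order condition
  says that the ray from \<open>(y, 0)\<close> to \<open>(x, d)\<close> leans by \<open>T y\<close> per unit of height, where the angle
  \<open>arctan (T y)\<close> with the vertical has sine \<open>- f' y\<close>; that is, \<open>x = y + d * T y\<close>. So the construction starts from \<open>T\<close>
  and recovers \<open>f\<close> by integrating \<open>- sin (arctan T)\<close>. If \<open>T\<close> is \<open>1\<close>-Lipschitz, the map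
  \<open>y \<mapsto> y + d * T y\<close> is an increasing bijection of the line for each \<open>0 < d < 1\<close>: the rays fill the
  strip of height \<open>1\<close> without crossing, and the critical foot is the global maximiser
  (\<open>foot_maximises\<close>).

  Two consequences hold for every such \<open>T\<close>. On the one hand \<open>u\<close> is \<open>1\<close>-Lipschitz and changes at
  unit rate along each ray, which extends beyond every point of the open strip in both directions.
  This alone forces \<open>u\<close> to be infinity harmonic
  (\<open>infinity_harmonic_on_if_affine_along_segments\<close>). On the other hand the gradient of \<open>u\<close> has
  \<open>x\<close>-component \<open>- sin (arctan (T y))\<close> all along the ray of \<open>y\<close>, so a failure of differentiability
  of \<open>T\<close> at \<open>y\<close> is carried along the whole ray
  (\<open>cone_sup_not_twice_differentiable\<close>).

  It remains to choose a \<open>1\<close>-Lipschitz \<open>T\<close> that is differentiable at no rational point and bounded, so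
  that \<open>\<bar>f'\<bar>\<close> stays away from \<open>1\<close>: a convex series of corners at the rationals (\<open>corner_sum\<close>), followed
  by \<open>arctan\<close>. The rays of rational feet are dense in the strip.
\<close>

section \<open>Functions that are affine along the gradient direction\<close>

lemma linear_functional_Basis_sum:
  fixes D :: "'a::euclidean_space \<Rightarrow> real"
  assumes "linear D"
  shows "D w = (\<Sum>i\<in>Basis. (w \<bullet> i) * D i)"
proof -
  have "D w = D (\<Sum>i\<in>Basis. (w \<bullet> i) *\<^sub>R i)" by (simp add: euclidean_representation)
  then show ?thesis by (simp add: linear_sum[OF assms] linear_scale[OF assms])
qed

lemma has_derivative_along_line:
  fixes \<phi> :: "'a::real_normed_vector \<Rightarrow> real"
  assumes D: "(\<phi> has_derivative D) (at (p + t *\<^sub>R v))"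
  shows "((\<lambda>t. \<phi> (p + t *\<^sub>R v)) has_real_derivative D v) (at t)"
proof -
  have "((\<lambda>t::real. p + t *\<^sub>R v) has_derivative (\<lambda>h. h *\<^sub>R v)) (at t)"
    by (auto intro!: derivative_eq_intros)
  from has_derivative_compose[OF this D] show ?thesis
    by (simp add: has_field_derivative_def linear_scale[OF has_derivative_linear[OF D]]
        mult.commute[of _ "D v"])
qed

lemma has_derivative_lower_bound:
  fixes \<phi> :: "'a::euclidean_space \<Rightarrow> real"
  assumes D: "(\<phi> has_derivative D) (at p)"
    and low: "\<forall>\<^sub>F q in nhds p. \<phi> q \<ge> \<phi> p - L * norm (q - p)"
  shows "D w \<ge> - L * norm w"
proof -
  have "((\<lambda>t. \<phi> (p + t *\<^sub>R w)) has_real_derivative D w) (at 0)"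
    using D by (intro has_derivative_along_line) simp
  then have "((\<lambda>t. (\<phi> (p + t *\<^sub>R w) - \<phi> p) / t) \<longlongrightarrow> D w) (at 0)"
    by (simp add: DERIV_def)
  then have lim: "((\<lambda>t. (\<phi> (p + t *\<^sub>R w) - \<phi> p) / t) \<longlongrightarrow> D w) (at_right 0)"
    by (rule filterlim_mono[OF _ order_refl]) (simp add: at_le)
  have "((\<lambda>t::real. p + t *\<^sub>R w) \<longlongrightarrow> p) (at_right 0)"
    by (auto intro!: tendsto_eq_intros)
  then have "\<forall>\<^sub>F t in at_right 0. \<phi> (p + t *\<^sub>R w) \<ge> \<phi> p - L * norm (p + t *\<^sub>R w - p)"
    by (rule eventually_compose_filterlim[OF low])
  then have "\<forall>\<^sub>F t in at_right 0. (\<phi> (p + t *\<^sub>R w) - \<phi> p) / t \<ge> - L * norm w"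
    using eventually_at_right_less[of 0]
    by eventually_elim (simp add: field_simps)
  then show ?thesis
    using tendsto_lowerbound[OF lim] by simp
qed

text \<open>The bound says that the gradient has norm at most \<open>L\<close>, so a directional derivative of
  size \<open>L\<close> is the equality case of the Cauchy-Schwarz inequality.\<close>

lemma derivative_of_extremal_direction:
  fixes \<phi> :: "'a::euclidean_space \<Rightarrow> real"
  assumes D: "(\<phi> has_derivative D) (at p)"
    and low: "\<forall>\<^sub>F q in nhds p. \<phi> q \<ge> \<phi> p - L * norm (q - p)"
    and v: "norm v = 1" "D v = L"
  shows "D w = L * (v \<bullet> w)"
proof -
  have lin: "linear D" using D has_derivative_linear by blast
  define g where "g = (\<Sum>i\<in>Basis. D i *\<^sub>R i)"
  have Dg: "D w = g \<bullet> w" for w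
    using linear_functional_Basis_sum[OF lin, of w]
    by (simp add: g_def inner_sum_left inner_commute[of w] mult.commute)
  have "L \<ge> 0"
    using has_derivative_lower_bound[OF D low, of v] v by simp
  have "D (- g) \<ge> - L * norm (- g)"
    by (rule has_derivative_lower_bound[OF D low])
  then have "norm g * norm g \<le> L * norm g"
    by (simp add: Dg dot_square_norm power2_eq_square)
  then have "norm g \<le> L"
    using \<open>L \<ge> 0\<close> by (cases "norm g = 0") auto
  then have "norm g ^ 2 \<le> L ^ 2" by (simp add: power_mono)
  moreover have "norm (g - L *\<^sub>R v) ^ 2 = norm g ^ 2 - 2 * L * (g \<bullet> v) + L ^ 2 * norm v ^ 2"
    by (simp only: power2_norm_eq_inner)
      (simp add: inner_diff_left inner_diff_right inner_commute power2_eq_square algebra_simps)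
  moreover have "g \<bullet> v = L" using v(2) Dg by simp
  ultimately have "norm (g - L *\<^sub>R v) ^ 2 \<le> 0"
    using v(1) by (simp add: power2_eq_square)
  then have "g = L *\<^sub>R v" by simp
  then show ?thesis using Dg by simp
qed

lemma second_derivative_nonneg_at_local_min:
  fixes g g' :: "real \<Rightarrow> real"
  assumes g: "\<forall>\<^sub>F t in nhds 0. (g has_real_derivative g' t) (at t)"
    and g': "(g' has_real_derivative Q) (at 0)"
    and min: "\<forall>\<^sub>F t in nhds 0. g 0 \<le> g t"
  shows "g' 0 = 0" "Q \<ge> 0"
proof -
  obtain e where e: "e > 0" "\<And>t. \<bar>t\<bar> < e \<Longrightarrow> (g has_real_derivative g' t) (at t) \<and> g 0 \<le> g t"
    using eventually_conj[OF g min]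
    unfolding eventually_nhds_metric by (auto simp: dist_real_def)
  show z: "g' 0 = 0"
    by (rule DERIV_local_min[of g "g' 0" 0 e]) (use e in auto)
  show "Q \<ge> 0"
  proof (rule ccontr)
    assume "\<not> Q \<ge> 0"
    then obtain r where r: "r > 0" "\<And>h. h > 0 \<Longrightarrow> h < r \<Longrightarrow> g' h < 0"
      using DERIV_neg_dec_right[OF g'] z by auto
    define h where "h = min e r / 2"
    have h: "0 < h" "h < e" "h < r" using e(1) r(1) by (auto simp: h_def)
    have "\<exists>l. (g has_real_derivative l) (at x) \<and> l < 0" if "0 < x" "x < h" for x
      using that h e(2)[of x] r(2)[of x] by auto
    moreover have "continuous_on {0..h} g"
    proof (intro continuous_at_imp_continuous_on ballI)
      fix x assume "x \<in> {0..h}"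
      then show "isCont g x"
        using e(2)[of x] h by (auto intro: DERIV_isCont)
    qed
    ultimately have "g h < g 0"
      using DERIV_neg_imp_decreasing_open[of 0 h g] h by blast
    with e(2)[of h] h show False by auto
  qed
qed

lemma has_derivative_partial_deriv_sum:
  fixes \<phi> :: "'a::euclidean_space \<Rightarrow> real"
  assumes "\<phi> differentiable (at q)"
  shows "(\<phi> has_derivative (\<lambda>w. \<Sum>i\<in>Basis. (w \<bullet> i) * partial_deriv i \<phi> q)) (at q)"
proof -
  let ?D = "frechet_derivative \<phi> (at q)"
  have D: "(\<phi> has_derivative ?D) (at q)"
    using assms frechet_derivative_works by blast
  have "?D = (\<lambda>w. \<Sum>i\<in>Basis. (w \<bullet> i) * partial_deriv i \<phi> q)"
    unfolding partial_deriv_def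
    by (rule ext, rule linear_functional_Basis_sum) (rule has_derivative_linear[OF D])
  with D show ?thesis by simp
qed

lemma C2_on_second_derivative_along_line:
  fixes \<phi> :: "'a::euclidean_space \<Rightarrow> real" and v :: 'a
  assumes \<Omega>: "open \<Omega>" "p \<in> \<Omega>" and C2: "C2_on \<Omega> \<phi>"
  defines "g' \<equiv> (\<lambda>t. \<Sum>i\<in>Basis. (v \<bullet> i) * partial_deriv i \<phi> (p + t *\<^sub>R v))"
  shows "\<forall>\<^sub>F t in nhds 0. ((\<lambda>t. \<phi> (p + t *\<^sub>R v)) has_real_derivative g' t) (at t)"
    and "(g' has_real_derivative
           (\<Sum>i\<in>Basis. \<Sum>j\<in>Basis. (v \<bullet> i) * (v \<bullet> j) * partial_deriv j (partial_deriv i \<phi>) p)) (at 0)"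
proof -
  have "((\<lambda>t::real. p + t *\<^sub>R v) \<longlongrightarrow> p + 0 *\<^sub>R v) (nhds 0)"
    by (intro tendsto_intros filterlim_ident)
  then have "\<forall>\<^sub>F t in nhds 0. p + t *\<^sub>R v \<in> \<Omega>"
    using \<Omega> topological_tendstoD by fastforce
  then show "\<forall>\<^sub>F t in nhds 0. ((\<lambda>t. \<phi> (p + t *\<^sub>R v)) has_real_derivative g' t) (at t)"
    by (rule eventually_mono)
      (use C2 in \<open>auto simp: C2_on_def g'_def intro!: has_derivative_along_line[OF has_derivative_partial_deriv_sum]\<close>)
  have "((\<lambda>t. partial_deriv i \<phi> (p + t *\<^sub>R v)) has_real_derivative
           (\<Sum>j\<in>Basis. (v \<bullet> j) * partial_deriv j (partial_deriv i \<phi>) p)) (at 0)"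
    if "i \<in> Basis" for i
    using has_derivative_along_line[OF has_derivative_partial_deriv_sum,
        of "partial_deriv i \<phi>" p 0 v] C2 \<Omega>(2) that
    by (auto simp: C2_on_def)
  then show "(g' has_real_derivative
      (\<Sum>i\<in>Basis. \<Sum>j\<in>Basis. (v \<bullet> i) * (v \<bullet> j) * partial_deriv j (partial_deriv i \<phi>) p)) (at 0)"
    unfolding g'_def
    by (auto intro!: derivative_eq_intros DERIV_sum simp: sum_distrib_left mult_ac)
qed

lemma infinity_laplacian_along_gradient:
  assumes "\<And>i. i \<in> Basis \<Longrightarrow> partial_deriv i \<phi> p = L * (v \<bullet> i)"
  shows "infinity_laplacian \<phi> p = L\<^sup>2 *
    (\<Sum>i\<in>Basis. \<Sum>j\<in>Basis. (v \<bullet> i) * (v \<bullet> j) * partial_deriv j (partial_deriv i \<phi>) p)"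
  unfolding infinity_laplacian_def
  by (simp add: assms sum_distrib_left power2_eq_square mult_ac)

text \<open>The analytic core. The segment fixes the derivative of a touching test function \<open>\<phi>\<close> in the
  direction \<open>v\<close> to be \<open>L\<close>, and the Lipschitz bound then leaves only \<open>L v\<close> for its gradient. So
  the infinity Laplacian of \<open>\<phi>\<close> is \<open>L\<^sup>2\<close> times its second derivative along the very segment on
  which \<open>u\<close> is affine, and there \<open>\<phi>\<close> touches an affine function from the
  same side as \<open>u\<close>.\<close>

theorem infinity_harmonic_on_if_affine_along_segments:
  fixes u :: "'a::euclidean_space \<Rightarrow> real"
  assumes \<Omega>: "open \<Omega>"
    and lip: "L-lipschitz_on \<Omega> u"
    and seg: "\<And>p. p \<in> \<Omega> \<Longrightarrow> \<exists>v. norm v = 1 \<and> (\<forall>\<^sub>F t in nhds 0. u (p + t *\<^sub>R v) = u p + L * t)"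
  shows "infinity_harmonic_on \<Omega> u"
  unfolding infinity_harmonic_on_def
proof (intro conjI allI impI; (elim conjE)?)
  show "continuous_on \<Omega> u" using lip lipschitz_on_continuous_on by blast
next
  fix \<phi> p
  assume C2: "C2_on \<Omega> \<phi>" and p: "p \<in> \<Omega>"
    and touch: "\<forall>\<^sub>F q in nhds p. u q - \<phi> q \<le> u p - \<phi> p"
  obtain v where v: "norm v = 1" "\<forall>\<^sub>F t in nhds 0. u (p + t *\<^sub>R v) = u p + L * t"
    using seg[OF p] by blast
  let ?D = "\<lambda>w. \<Sum>i\<in>Basis. (w \<bullet> i) * partial_deriv i \<phi> p"
  have D: "(\<phi> has_derivative ?D) (at p)"
    using C2 p by (auto simp: C2_on_def intro!: has_derivative_partial_deriv_sum)
  have low: "\<forall>\<^sub>F q in nhds p. \<phi> q \<ge> \<phi> p - L * norm (q - p)"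
    using touch eventually_nhds_in_open[OF \<Omega> p]
  proof eventually_elim
    case (elim q)
    then show ?case
      using lipschitz_onD[OF lip, of q p] p by (auto simp: dist_norm)
  qed
  let ?g' = "\<lambda>t. (\<Sum>i\<in>Basis. (v \<bullet> i) * partial_deriv i \<phi> (p + t *\<^sub>R v)) - L"
  let ?Q = "\<Sum>i\<in>Basis. \<Sum>j\<in>Basis. (v \<bullet> i) * (v \<bullet> j) * partial_deriv j (partial_deriv i \<phi>) p"
  have line: "((\<lambda>t::real. p + t *\<^sub>R v) \<longlongrightarrow> p) (nhds 0)"
    by (auto intro!: tendsto_eq_intros filterlim_ident)
  note d = C2_on_second_derivative_along_line[OF \<Omega> p C2, of v]
  have 1: "\<forall>\<^sub>F t in nhds 0. ((\<lambda>t. \<phi> (p + t *\<^sub>R v) - L * t) has_real_derivative ?g' t) (at t)"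
    using d(1) by eventually_elim (auto intro!: derivative_eq_intros)
  have 2: "(?g' has_real_derivative ?Q) (at 0)"
    using DERIV_diff[OF d(2) DERIV_const[of L]] by simp
  have 3: "\<forall>\<^sub>F t in nhds 0. \<phi> (p + 0 *\<^sub>R v) - L * 0 \<le> \<phi> (p + t *\<^sub>R v) - L * t"
    using v(2) eventually_compose_filterlim[OF touch line] by eventually_elim simp
  have "?D v = L" "?Q \<ge> 0"
    using second_derivative_nonneg_at_local_min[OF 1 2 3] by auto
  have grad: "partial_deriv i \<phi> p = L * (v \<bullet> i)" if "i \<in> Basis" for i
    using derivative_of_extremal_direction[OF D low v(1) \<open>?D v = L\<close>, of i] that
    by (simp add: inner_Basis if_distrib[of "\<lambda>x. x * _"] cong: if_cong)
  show "infinity_laplacian \<phi> p \<ge> 0"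
    using infinity_laplacian_along_gradient[of \<phi> p L v, OF grad] \<open>?Q \<ge> 0\<close> by simp
next
  \<comment> \<open>Touching from below is touching from above for \<open>- u\<close> and \<open>- \<phi>\<close>, with \<open>- v\<close> in the role of \<open>v\<close>.\<close>
  fix \<phi> p
  assume C2: "C2_on \<Omega> \<phi>" and p: "p \<in> \<Omega>"
    and touch: "\<forall>\<^sub>F q in nhds p. u q - \<phi> q \<ge> u p - \<phi> p"
  obtain v where v: "norm v = 1" "\<forall>\<^sub>F t in nhds 0. u (p + t *\<^sub>R v) = u p + L * t"
    using seg[OF p] by blast
  let ?D = "\<lambda>w. \<Sum>i\<in>Basis. (w \<bullet> i) * partial_deriv i \<phi> p"
  have D: "((\<lambda>q. - \<phi> q) has_derivative (\<lambda>w. - ?D w)) (at p)"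
    using C2 p by (auto simp: C2_on_def intro!: has_derivative_minus has_derivative_partial_deriv_sum)
  have low: "\<forall>\<^sub>F q in nhds p. - \<phi> q \<ge> - \<phi> p - L * norm (q - p)"
    using touch eventually_nhds_in_open[OF \<Omega> p]
  proof eventually_elim
    case (elim q)
    then show ?case
      using lipschitz_onD[OF lip, of q p] p by (auto simp: dist_norm)
  qed
  let ?g' = "\<lambda>t. L - (\<Sum>i\<in>Basis. (v \<bullet> i) * partial_deriv i \<phi> (p + t *\<^sub>R v))"
  let ?Q = "\<Sum>i\<in>Basis. \<Sum>j\<in>Basis. (v \<bullet> i) * (v \<bullet> j) * partial_deriv j (partial_deriv i \<phi>) p"
  have line: "((\<lambda>t::real. p + t *\<^sub>R v) \<longlongrightarrow> p) (nhds 0)"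
    by (auto intro!: tendsto_eq_intros filterlim_ident)
  note d = C2_on_second_derivative_along_line[OF \<Omega> p C2, of v]
  have 1: "\<forall>\<^sub>F t in nhds 0. ((\<lambda>t. L * t - \<phi> (p + t *\<^sub>R v)) has_real_derivative ?g' t) (at t)"
    using d(1) by eventually_elim (auto intro!: derivative_eq_intros)
  have 2: "(?g' has_real_derivative - ?Q) (at 0)"
    using DERIV_diff[OF DERIV_const[of L] d(2)] by simp
  have 3: "\<forall>\<^sub>F t in nhds 0. L * 0 - \<phi> (p + 0 *\<^sub>R v) \<le> L * t - \<phi> (p + t *\<^sub>R v)"
    using v(2) eventually_compose_filterlim[OF touch line] by eventually_elim simp
  have "?D v = L" "?Q \<le> 0"
    using second_derivative_nonneg_at_local_min[OF 1 2 3] by auto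
  have "- ?D (- v) = L"
    using \<open>?D v = L\<close> by (simp add: sum_negf)
  have grad: "partial_deriv i \<phi> p = L * (v \<bullet> i)" if "i \<in> Basis" for i
    using derivative_of_extremal_direction[OF D low _ \<open>- ?D (- v) = L\<close>, of i] that v(1)
    by (simp add: inner_Basis if_distrib[of "\<lambda>x. x * _"] cong: if_cong)
  show "infinity_laplacian \<phi> p \<le> 0"
    using infinity_laplacian_along_gradient[of \<phi> p L v, OF grad] \<open>?Q \<le> 0\<close>
    by (simp add: mult_nonneg_nonpos)
qed (rule \<Omega>)

section \<open>A Lipschitz function with a dense set of corners\<close>

text \<open>Subtracting \<open>\<bar>a n\<bar>\<close> makes the series converge for every sequence \<open>a\<close>, bounded or not.\<close>

definition corner_sum :: "(nat \<Rightarrow> real) \<Rightarrow> real \<Rightarrow> real" where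
  "corner_sum a y = (\<Sum>n. (1/2) ^ Suc n * (\<bar>y - a n\<bar> - \<bar>a n\<bar>))"

lemma half_geometric_sums: "(\<lambda>n. (1/2) ^ Suc n * c) sums (c::real)"
  using sums_mult2[OF power_half_series, of c] by simp

lemma corner_sum_summable: "summable (\<lambda>n. (1/2) ^ Suc n * (\<bar>y - a n\<bar> - \<bar>a n\<bar>) :: real)"
proof (rule summable_comparison_test')
  show "summable (\<lambda>n. (1/2) ^ Suc n * \<bar>y\<bar>)"
    using half_geometric_sums sums_summable by blast
  show "norm ((1/2) ^ Suc n * (\<bar>y - a n\<bar> - \<bar>a n\<bar>)) \<le> (1/2) ^ Suc n * \<bar>y\<bar>" if "n \<ge> 0" for n
    unfolding norm_mult by (intro mult_mono) auto
qed

lemma corner_sum_lipschitz: "1-lipschitz_on UNIV (corner_sum a)"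
proof (rule lipschitz_onI)
  fix y z :: real
  have eq: "corner_sum a y - corner_sum a z =
      (\<Sum>n. (1/2) ^ Suc n * (\<bar>y - a n\<bar> - \<bar>a n\<bar>) - (1/2) ^ Suc n * (\<bar>z - a n\<bar> - \<bar>a n\<bar>))"
    unfolding corner_sum_def by (rule suminf_diff) (rule corner_sum_summable)+
  have "norm (\<Sum>n. (1/2) ^ Suc n * (\<bar>y - a n\<bar> - \<bar>a n\<bar>) - (1/2) ^ Suc n * (\<bar>z - a n\<bar> - \<bar>a n\<bar>))
      \<le> (\<Sum>n. (1/2) ^ Suc n * \<bar>y - z\<bar>)"
  proof (rule norm_suminf_le)
    show "summable (\<lambda>n. (1/2) ^ Suc n * \<bar>y - z\<bar>)"
      using half_geometric_sums sums_summable by blast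
    show "norm ((1/2) ^ Suc n * (\<bar>y - a n\<bar> - \<bar>a n\<bar>) - (1/2) ^ Suc n * (\<bar>z - a n\<bar> - \<bar>a n\<bar>))
        \<le> (1/2) ^ Suc n * \<bar>y - z\<bar>" for n
      unfolding right_diff_distrib[symmetric] norm_mult
      by (intro mult_mono) auto
  qed
  then show "dist (corner_sum a y) (corner_sum a z) \<le> 1 * dist y z"
    using eq sums_unique[OF half_geometric_sums[of "\<bar>y - z\<bar>"]] by (simp add: dist_real_def)
qed simp


text \<open>At \<open>a m\<close> the \<open>m\<close>-th summand alone makes the second difference of step \<open>h\<close> at least a fixed
  multiple of \<open>h\<close>; by convexity the other summands cannot compensate.\<close>

lemma corner_sum_second_difference:
  assumes "h > 0"
  shows "corner_sum a (a m + h) + corner_sum a (a m - h) - 2 * corner_sum a (a m) \<ge> (1/2) ^ m * h"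
proof -
  let ?t = "\<lambda>y n. (1/2) ^ Suc n * (\<bar>y - a n\<bar> - \<bar>a n\<bar>) :: real"
  let ?s = "\<lambda>n. ?t (a m + h) n + ?t (a m - h) n - 2 * ?t (a m) n"
  have "?s sums (corner_sum a (a m + h) + corner_sum a (a m - h) - 2 * corner_sum a (a m))"
    unfolding corner_sum_def
    by (intro sums_diff sums_add sums_mult summable_sums corner_sum_summable)
  moreover have "sum ?s {m} \<le> suminf ?s"
  proof (rule sum_le_suminf)
    show "summable ?s"
      by (intro summable_diff summable_add summable_mult corner_sum_summable)
    have "?s n = (1/2) ^ Suc n * (\<bar>a m + h - a n\<bar> + \<bar>a m - h - a n\<bar> - 2 * \<bar>a m - a n\<bar>)" for n
      by (simp add: field_simps)
    moreover have "0 \<le> \<bar>a m + h - a n\<bar> + \<bar>a m - h - a n\<bar> - 2 * \<bar>a m - a n\<bar>" for n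
      by (auto simp: abs_if)
    ultimately show "0 \<le> ?s n" for n
      by (simp del: power_Suc)
  qed simp
  moreover have "?s m = (1/2) ^ m * h"
    using assms by (simp add: field_simps)
  ultimately show ?thesis
    by (simp add: sums_iff)
qed

lemma corner_sum_not_differentiable: "\<not> corner_sum a differentiable (at (a m))"
proof
  let ?C = "corner_sum a" and ?y = "a m"
  assume "?C differentiable (at ?y)"
  then obtain l where "(?C has_real_derivative l) (at ?y)"
    by (auto simp: real_differentiable_def)
  then have l: "((\<lambda>h. (?C (?y + h) - ?C ?y) / h) \<longlongrightarrow> l) (at 0)"
    by (simp add: DERIV_def)
  have "((\<lambda>h. (?C (?y - h) - ?C ?y) / - h) \<longlongrightarrow> l) (at 0)"
  proof -
    have "filterlim uminus (at 0) (at (0::real))"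
      by (auto simp: filterlim_at eventually_at_filter intro!: tendsto_eq_intros)
    from filterlim_compose[OF l this] show ?thesis by simp
  qed
  with l have "((\<lambda>h. (?C (?y + h) - ?C ?y) / h - (?C (?y - h) - ?C ?y) / - h) \<longlongrightarrow> l - l) (at 0)"
    by (rule tendsto_diff)
  then have "((\<lambda>h. (?C (?y + h) - ?C ?y) / h - (?C (?y - h) - ?C ?y) / - h) \<longlongrightarrow> l - l) (at_right 0)"
    by (rule filterlim_mono[OF _ order_refl]) (simp add: at_le)
  moreover have "\<forall>\<^sub>F h in at_right 0.
      (?C (?y + h) - ?C ?y) / h - (?C (?y - h) - ?C ?y) / - h \<ge> (1/2) ^ m"
    using eventually_at_right_less[of 0]
  proof eventually_elim
    case (elim h)
    have "(?C (?y + h) - ?C ?y) / h - (?C (?y - h) - ?C ?y) / - h =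
        (?C (?y + h) + ?C (?y - h) - 2 * ?C ?y) / h"
      using elim by (simp add: field_simps)
    then show ?case
      using corner_sum_second_difference[where h = h and a = a and m = m] elim by (simp add: pos_le_divide_eq)
  qed
  ultimately have "l - l \<ge> (1/2) ^ m"
    using tendsto_lowerbound trivial_limit_at_right_real by blast
  then show False using zero_less_power[of "1/2::real" m] by linarith
qed

section \<open>The fan of rays issuing from the axis\<close>

lemma arctan_lipschitz: "1-lipschitz_on S arctan"
proof (rule lipschitz_on_subset)
  have "\<bar>h * inverse (1 + x\<^sup>2)\<bar> \<le> 1 * \<bar>h\<bar>" for x h :: real
    by (simp add: abs_mult mult_left_le inverse_le_1_iff)
  then show "1-lipschitz_on UNIV arctan"
    by (intro bounded_derivative_imp_lipschitz[where f' = "\<lambda>x h. h * inverse (1 + x\<^sup>2)"])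
      (auto intro!: derivative_eq_intros onorm_le)
qed simp

lemma sin_lipschitz: "1-lipschitz_on S (sin :: real \<Rightarrow> real)"
proof (rule lipschitz_on_subset)
  show "1-lipschitz_on UNIV (sin :: real \<Rightarrow> real)"
    by (rule bounded_derivative_imp_lipschitz[where f' = "\<lambda>x h. h * cos x"])
      (auto intro!: derivative_eq_intros onorm_le simp: abs_mult mult_left_le)
qed simp

lemma sin_arctan_mono: "a \<le> b \<Longrightarrow> sin (arctan a) \<le> sin (arctan b)"
  using arctan_lbound[of a] arctan_ubound[of b]
  by (intro sin_monotone_2pi_le) (auto simp: arctan_le_iff less_imp_le)

lemma abs_sin_arctan_less_1: "\<bar>sin (arctan t)\<bar> < 1"
  by (simp add: abs_square_less_1[symmetric] sin_squared_eq)

lemma sin_arctan_divide: "d > 0 \<Longrightarrow> sin (arctan (x / d)) = x / sqrt (x\<^sup>2 + d\<^sup>2)"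
proof -
  assume "d > 0"
  then have "sqrt (x\<^sup>2 + d\<^sup>2) = d * sqrt (1 + (x / d)\<^sup>2)"
    by (intro real_sqrt_unique) (auto simp: power_mult_distrib field_simps)
  then show ?thesis using \<open>d > 0\<close> by (simp add: sin_arctan)
qed

locale ray_fan =
  fixes T f :: "real \<Rightarrow> real"
  assumes lip: "1-lipschitz_on UNIV T"
    and deriv: "(f has_real_derivative - sin (arctan (T y))) (at y)"
begin

definition ray :: "real \<Rightarrow> real \<Rightarrow> real" where
  "ray d y = y + d * T y"

lemma ray_strict_mono:
  assumes "0 < d" "d < 1" "y < z"
  shows "ray d y < ray d z"
proof -
  have "d * \<bar>T y - T z\<bar> \<le> d * (z - y)"
    using lipschitz_onD[OF lip, of y z] assms by (simp add: dist_real_def)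
  moreover have "d * (z - y) < z - y"
    using assms by simp
  moreover have "d * (T y - T z) \<le> d * \<bar>T y - T z\<bar>"
    using assms by (simp add: mult_left_mono)
  ultimately show ?thesis by (simp add: ray_def algebra_simps)
qed

lemma ray_inj: "0 < d \<Longrightarrow> d < 1 \<Longrightarrow> ray d y = ray d z \<Longrightarrow> y = z"
  using ray_strict_mono[of d] by (metis less_irrefl linorder_cases)

lemma ray_lipschitz:
  assumes "0 < d" "d < 1"
  shows "\<bar>ray d y - ray d z\<bar> \<le> 2 * \<bar>y - z\<bar>"
proof -
  have "d * \<bar>T y - T z\<bar> \<le> 1 * \<bar>y - z\<bar>"
    using lipschitz_onD[OF lip, of y z] assms by (intro mult_mono) (auto simp: dist_real_def)
  then have T: "\<bar>d * (T y - T z)\<bar> \<le> \<bar>y - z\<bar>"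
    using assms by (simp add: abs_mult)
  have "\<bar>ray d y - ray d z\<bar> = \<bar>(y - z) + d * (T y - T z)\<bar>"
    by (simp add: ray_def algebra_simps)
  also have "\<dots> \<le> \<bar>y - z\<bar> + \<bar>d * (T y - T z)\<bar>"
    by (rule abs_triangle_ineq)
  also have "\<dots> \<le> \<bar>y - z\<bar> + \<bar>y - z\<bar>"
    using T by (rule add_left_mono)
  finally show ?thesis by simp
qed

lemma continuous_T: "continuous_on UNIV T"
  using lip lipschitz_on_continuous_on by blast

lemma continuous_ray: "continuous_on UNIV (ray d)"
  unfolding ray_def using continuous_T by (intro continuous_intros) auto

lemma ray_surj:
  assumes "0 < d" "d < 1"
  shows "\<exists>y. ray d y = x"
proof -
  \<comment> \<open>\<open>T\<close> grows at most linearly, so \<open>r\<close> solves \<open>r - (d * r + \<bar>T 0\<bar>) = \<bar>x\<bar>\<close> and brackets \<open>x\<close>.\<close>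
  define r where "r = (\<bar>x\<bar> + \<bar>T 0\<bar>) / (1 - d)"
  have "r \<ge> 0" using assms by (simp add: r_def)
  have r: "r - d * r = \<bar>x\<bar> + \<bar>T 0\<bar>"
  proof -
    have "r * (1 - d) = \<bar>x\<bar> + \<bar>T 0\<bar>" using assms by (simp add: r_def)
    then show ?thesis by (simp add: algebra_simps)
  qed
  have d0: "d * \<bar>T 0\<bar> \<le> \<bar>T 0\<bar>" using assms by (simp add: mult_left_le_one_le)
  have T: "\<bar>d * T y\<bar> \<le> d * r + \<bar>T 0\<bar>" if "\<bar>y\<bar> = r" for y
  proof -
    have "\<bar>T y\<bar> \<le> r + \<bar>T 0\<bar>"
      using lipschitz_onD[OF lip, of y 0] that by (auto simp: dist_real_def)
    then have "d * \<bar>T y\<bar> \<le> d * r + d * \<bar>T 0\<bar>"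
      using assms by (simp add: distrib_left[symmetric])
    then show ?thesis using d0 assms by (simp add: abs_mult)
  qed
  have "\<bar>d * T r\<bar> \<le> d * r + \<bar>T 0\<bar>" "\<bar>d * T (- r)\<bar> \<le> d * r + \<bar>T 0\<bar>"
    using T \<open>r \<ge> 0\<close> by auto
  then have "ray d (- r) \<le> x" "x \<le> ray d r"
    using r unfolding ray_def by linarith+
  then show ?thesis
    using IVT'[of "ray d" "- r" x r] \<open>r \<ge> 0\<close> continuous_on_subset[OF continuous_ray] by auto
qed

text \<open>The derivative in \<open>z\<close> of the function maximised has the sign of \<open>x - ray d z\<close>, because
  \<open>(x - z) / sqrt ((x - z)\<^sup>2 + d\<^sup>2)\<close> is the sine of the angle at which \<open>(x, d)\<close> is seen
  from \<open>(z, 0)\<close>.\<close>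

lemma foot_maximises:
  assumes d: "0 < d" "d < 1"
  shows "f z - sqrt ((ray d y - z)\<^sup>2 + d\<^sup>2) \<le> f y - sqrt ((ray d y - y)\<^sup>2 + d\<^sup>2)"
proof -
  define x where "x = ray d y"
  define F where "F z = f z - sqrt ((x - z)\<^sup>2 + d\<^sup>2)" for z
  have F: "(F has_real_derivative sin (arctan ((x - z) / d)) - sin (arctan (T z))) (at z)" for z
    unfolding F_def sin_arctan_divide[OF d(1)] using d
    by (auto intro!: derivative_eq_intros deriv simp: sum_power2_gt_zero_iff not_sum_power2_lt_zero divide_simps)
  have sgn: "T w \<le> (x - w) / d \<longleftrightarrow> ray d w \<le> x" "(x - w) / d \<le> T w \<longleftrightarrow> x \<le> ray d w" for w
    using d by (auto simp: ray_def field_simps)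
  have "F z \<le> F y"
  proof (cases "z \<le> y")
    case True
    show ?thesis
    proof (rule DERIV_nonneg_imp_nondecreasing[OF True])
      fix w assume "z \<le> w" "w \<le> y"
      then have "ray d w \<le> x"
        using ray_strict_mono[OF d, of w y] by (cases "w = y") (auto simp: x_def)
      then show "\<exists>l. (F has_real_derivative l) (at w) \<and> 0 \<le> l"
        using F[of w] sin_arctan_mono[of "T w" "(x - w) / d"] sgn(1)[of w] by auto
    qed
  next
    case False
    show ?thesis
    proof (rule DERIV_nonpos_imp_nonincreasing[of y z])
      fix w assume "y \<le> w" "w \<le> z"
      then have "x \<le> ray d w"
        using ray_strict_mono[OF d, of y w] by (cases "w = y") (auto simp: x_def)
      then show "\<exists>l. (F has_real_derivative l) (at w) \<and> l \<le> 0"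
        using F[of w] sin_arctan_mono[of "(x - w) / d" "T w"] sgn(2)[of w] by auto
    qed (use False in auto)
  qed
  then show ?thesis by (simp add: F_def x_def)
qed

lemma cone_sup_on_ray:
  assumes d: "0 < d" "d < 1"
  shows "cone_sup f 1 (ray d y, d) = f y - dist (ray d y, d) (y, 0)"
proof -
  have "cone_sup f 1 (ray d y, d) = (SUP z. f z - sqrt ((ray d y - z)\<^sup>2 + d\<^sup>2))"
    by (simp add: cone_sup_def)
  also have "\<dots> = f y - sqrt ((ray d y - y)\<^sup>2 + d\<^sup>2)"
    by (rule cSup_eq_maximum) (use foot_maximises[OF d] in auto)
  finally show ?thesis by (simp add: dist_Pair_Pair dist_real_def)
qed

lemma cone_sup_on_ray_slope:
  assumes d: "0 < d" "d < 1"
  shows "cone_sup f 1 (ray d y, d) = f y - d * sqrt (1 + (T y)\<^sup>2)"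
proof -
  have "dist (ray d y, d) (y, 0) = d * sqrt (1 + (T y)\<^sup>2)"
    unfolding dist_Pair_Pair dist_real_def using d
    by (intro real_sqrt_unique) (auto simp: ray_def power_mult_distrib algebra_simps)
  then show ?thesis using cone_sup_on_ray[OF d] by simp
qed

lemma strip_foot:
  assumes "p \<in> strip 1"
  obtains y d where "0 < d" "d < 1" "p = (ray d y, d)"
proof -
  obtain x d where p: "p = (x, d)" "0 < d" "d < 1" using assms by (auto simp: strip_def)
  then obtain y where "ray d y = x" using ray_surj by blast
  with p that show thesis by blast
qed

lemma cone_sup_ge:
  assumes "p \<in> strip 1"
  shows "f z - dist p (z, 0) \<le> cone_sup f 1 p"
  using assms
proof (rule strip_foot)
  fix y d assume d: "0 < d" "d < 1" "p = (ray d y, d)"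
  then show ?thesis
    using foot_maximises[OF d(1,2), of z y] cone_sup_on_ray[OF d(1,2), of y]
    by (simp add: dist_Pair_Pair dist_real_def)
qed

lemma cone_sup_lipschitz: "1-lipschitz_on (strip 1) (cone_sup f 1)"
proof -
  have *: "cone_sup f 1 p - cone_sup f 1 q \<le> dist p q" if p: "p \<in> strip 1" and q: "q \<in> strip 1" for p q
    using p
  proof (rule strip_foot)
    fix y d assume d: "0 < d" "d < 1" "p = (ray d y, d)"
    then show ?thesis
      using cone_sup_on_ray[OF d(1,2), of y] cone_sup_ge[OF q, of y] dist_triangle[of q "(y, 0)" p]
      by (simp add: dist_commute)
  qed
  show ?thesis
  proof (rule lipschitz_onI)
    fix p q :: "real \<times> real" assume "p \<in> strip 1" "q \<in> strip 1"
    then show "dist (cone_sup f 1 p) (cone_sup f 1 q) \<le> 1 * dist p q"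
      using *[of p q] *[of q p] by (simp add: dist_real_def dist_commute abs_le_iff)
  qed simp
qed

text \<open>The cone \<open>f y - dist p (y, 0)\<close> increases towards its vertex, so this is the direction from any point
  of the ray of \<open>y\<close> back to the foot.\<close>

definition ascent :: "real \<Rightarrow> real \<times> real" where
  "ascent y = (- sin (arctan (T y)), - cos (arctan (T y)))"

lemma norm_ascent: "norm (ascent y) = 1"
  by (simp add: ascent_def norm_Pair)

lemma cone_sup_affine_along_ray:
  assumes d: "0 < d" "d < 1"
  shows "\<forall>\<^sub>F t in nhds 0.
    cone_sup f 1 ((ray d y, d) + t *\<^sub>R ascent y) = cone_sup f 1 (ray d y, d) + t"
proof -
  let ?e = "\<lambda>t. d - t * cos (arctan (T y))"
  have "(?e \<longlongrightarrow> d - 0 * cos (arctan (T y))) (nhds 0)"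
    by (intro tendsto_intros filterlim_ident)
  then have "\<forall>\<^sub>F t in nhds 0. ?e t \<in> {0<..<1}"
    by (rule topological_tendstoD) (use d in auto)
  then show ?thesis
  proof eventually_elim
    case (elim t)
    have "cos (arctan (T y)) * T y = sin (arctan (T y))"
      by (simp add: sin_arctan cos_arctan)
    then have "(ray d y, d) + t *\<^sub>R ascent y = (ray (?e t) y, ?e t)"
      by (simp add: ascent_def ray_def algebra_simps)
    moreover have "cos (arctan (T y)) * sqrt (1 + (T y)\<^sup>2) = 1"
      by (simp add: cos_arctan add_pos_nonneg less_imp_neq[symmetric])
    ultimately show ?case
      using elim cone_sup_on_ray_slope[of "?e t" y] cone_sup_on_ray_slope[OF d, of y]
      by (simp add: algebra_simps)
  qed
qed

lemma open_strip: "open (strip \<delta>)"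
proof -
  have "strip \<delta> = UNIV \<times> {0<..<\<delta>}" by (auto simp: strip_def)
  then show ?thesis by (simp add: open_Times)
qed

theorem cone_sup_infinity_harmonic: "infinity_harmonic_on (strip 1) (cone_sup f 1)"
proof (rule infinity_harmonic_on_if_affine_along_segments[OF open_strip cone_sup_lipschitz])
  fix p :: "real \<times> real" assume "p \<in> strip 1"
  then obtain y d where "0 < d" "d < 1" "p = (ray d y, d)" by (rule strip_foot)
  then show "\<exists>v. norm v = 1 \<and> (\<forall>\<^sub>F t in nhds 0. cone_sup f 1 (p + t *\<^sub>R v) = cone_sup f 1 p + 1 * t)"
    using norm_ascent[of y] cone_sup_affine_along_ray[of d y] by (intro exI[of _ "ascent y"]) simp
qed

text \<open>Being \<open>1\<close>-Lipschitz with slope \<open>1\<close> along \<open>ascent y\<close>, the function itself satisfies the conditions that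
  pinned down the gradient of a test function.\<close>

lemma grad_cone_sup:
  assumes d: "0 < d" "d < 1"
    and diff: "cone_sup f 1 differentiable (at (ray d y, d))"
  shows "grad (cone_sup f 1) (ray d y, d) \<bullet> (1, 0) = - sin (arctan (T y))"
proof -
  let ?u = "cone_sup f 1" and ?p = "(ray d y, d)"
  let ?D = "frechet_derivative ?u (at ?p)"
  have D: "(?u has_derivative ?D) (at ?p)"
    using diff frechet_derivative_works by blast
  have p: "?p \<in> strip 1" using d by (simp add: strip_def)
  have low: "\<forall>\<^sub>F q in nhds ?p. ?u q \<ge> ?u ?p - 1 * norm (q - ?p)"
    using eventually_nhds_in_open[OF open_strip p]
  proof eventually_elim
    case (elim q)
    then show ?case
      using lipschitz_onD[OF cone_sup_lipschitz, of q ?p] p by (auto simp: dist_norm)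
  qed
  have "((\<lambda>t. ?u (?p + t *\<^sub>R ascent y)) has_real_derivative ?D (ascent y)) (at 0)"
    using D by (intro has_derivative_along_line) simp
  moreover have "((\<lambda>t. ?u (?p + t *\<^sub>R ascent y)) has_real_derivative 1) (at 0) \<longleftrightarrow>
      ((\<lambda>t. ?u ?p + t) has_real_derivative 1) (at 0)"
    by (rule DERIV_cong_ev) (use cone_sup_affine_along_ray[OF d] in auto)
  then have "((\<lambda>t. ?u (?p + t *\<^sub>R ascent y)) has_real_derivative 1) (at 0)"
    by (auto intro!: derivative_eq_intros)
  ultimately have "?D (ascent y) = 1"
    using DERIV_unique by blast
  then have "?D (1, 0) = 1 * (ascent y \<bullet> (1, 0))"
    by (rule derivative_of_extremal_direction[OF D low norm_ascent])
  then have "partial_deriv (1, 0) ?u ?p = - sin (arctan (T y))"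
    by (simp add: partial_deriv_def ascent_def)
  moreover have "(1, 0) \<in> (Basis :: (real \<times> real) set)"
    by (simp add: Basis_prod_def)
  ultimately show ?thesis
    by (simp add: grad_def inner_sum_left_Basis)
qed

text \<open>On a horizontal line the \<open>x\<close>-derivative of \<open>u\<close> is a smooth invertible function of \<open>T\<close> at
  the foot. If it were differentiable, the foot \<open>Y x = x - d * T (Y x)\<close> would be differentiable in \<open>x\<close>,
  with nonzero derivative as its inverse \<open>ray d\<close> is Lipschitz. Then \<open>ray d\<close>, and with
  it \<open>T\<close>, would be differentiable too.\<close>

theorem cone_sup_not_twice_differentiable:
  assumes d: "0 < d" "d < 1"
    and T: "\<not> T differentiable (at y)"
  shows "\<not> twice_differentiable_at (cone_sup f 1) (ray d y, d)"
proof
  let ?u = "cone_sup f 1" and ?x = "ray d y"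
  assume "twice_differentiable_at ?u (?x, d)"
  then have ev: "\<forall>\<^sub>F q in nhds (?x, d). ?u differentiable (at q)"
    and dgrad: "grad ?u differentiable (at (?x, d))"
    by (auto simp: twice_differentiable_at_def)
  obtain Y where Y: "\<And>x. ray d (Y x) = x"
    using ray_surj[OF d] by metis
  have Yray: "Y (ray d z) = z" for z
    using ray_inj[OF d] Y by blast
  define h where "h x = grad ?u (x, d) \<bullet> (1, 0)" for x
  have "(grad ?u \<circ> (\<lambda>x. (x, d))) differentiable (at ?x)"
    by (rule differentiable_chain_at) (use dgrad in \<open>auto intro!: derivative_intros simp: differentiable_def\<close>)
  then have "h differentiable (at ?x)"
    unfolding h_def o_def
    by (auto simp: differentiable_def intro!: derivative_intros)
  then obtain h' where h': "(h has_real_derivative h') (at ?x)"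
    by (auto simp: real_differentiable_def)
  have line: "((\<lambda>x. (x, d)) \<longlongrightarrow> (?x, d)) (nhds ?x)"
    by (intro tendsto_intros filterlim_ident)
  have h: "\<forall>\<^sub>F x in nhds ?x. h x = - sin (arctan (T (Y x)))"
    using eventually_compose_filterlim[OF ev line]
  proof eventually_elim
    case (elim x)
    then show ?case
      using grad_cone_sup[OF d, of "Y x"] by (simp add: h_def Y)
  qed
  have hx: "- h ?x = sin (arctan (T y))"
    using eventually_nhds_x_imp_x[OF h] by (simp add: Yray)
  have "-1 < - h ?x" "- h ?x < 1"
    unfolding hx using abs_sin_arctan_less_1[of "T y"] by (simp_all add: abs_less_iff)
  moreover have "arcsin (- h ?x) = arctan (T y)"
    unfolding hx using arctan_bounded[of "T y"] by (intro arcsin_sin) auto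
  ultimately have "\<exists>k. ((\<lambda>x. x - d * tan (arcsin (- h x))) has_real_derivative k) (at ?x)"
    using h' by (intro exI) (auto intro!: derivative_eq_intros)
  then obtain A where "((\<lambda>x. x - d * tan (arcsin (- h x))) has_real_derivative A) (at ?x)" ..
  moreover have Yh: "\<forall>\<^sub>F x in nhds ?x. Y x = x - d * tan (arcsin (- h x))"
    using h
  proof eventually_elim
    case (elim x)
    have "arcsin (- h x) = arctan (T (Y x))"
      unfolding elim minus_minus using arctan_bounded[of "T (Y x)"] by (intro arcsin_sin) auto
    then show ?case
      using Y[of x] by (simp add: ray_def tan_arctan)
  qed
  ultimately have A: "(Y has_real_derivative A) (at ?x)"
    by (simp add: DERIV_cong_ev[OF refl Yh refl])
  \<comment> \<open>The difference quotients of \<open>Y\<close> are at least \<open>1/2\<close> in absolute value, as its inverse is \<open>2\<close>-Lipschitz.\<close>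
  have "A \<noteq> 0"
  proof
    assume "A = 0"
    then have "((\<lambda>k. (Y (?x + k) - Y ?x) / k) \<longlongrightarrow> 0) (at 0)"
      using A by (simp add: DERIV_def)
    then have lim: "((\<lambda>k. \<bar>(Y (?x + k) - Y ?x) / k\<bar>) \<longlongrightarrow> 0) (at 0)"
      using tendsto_rabs_zero by blast
    have "\<bar>(Y (?x + k) - Y ?x) / k\<bar> \<ge> 1/2" if "k \<noteq> 0" for k
    proof -
      have "\<bar>ray d (Y (?x + k)) - ray d (Y ?x)\<bar> \<le> 2 * \<bar>Y (?x + k) - Y ?x\<bar>"
        using ray_lipschitz d by simp
      then show ?thesis using that by (simp add: Y field_simps)
    qed
    then have "\<forall>\<^sub>F k in at 0. \<bar>(Y (?x + k) - Y ?x) / k\<bar> \<ge> 1/2"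
      by (auto simp: eventually_at intro: exI[of _ 1])
    then show False
      using tendsto_lowerbound[OF lim] by fastforce
  qed
  have "(ray d has_real_derivative inverse A) (at y)"
  proof (rule has_field_derivative_inverse_basic[where f = Y and t = UNIV])
    show "continuous (at y) (ray d)"
      using continuous_ray continuous_on_eq_continuous_at open_UNIV by blast
  qed (use A \<open>A \<noteq> 0\<close> Yray in auto)
  then have "((\<lambda>z. (ray d z - z) / d) has_real_derivative (inverse A - 1) / d) (at y)"
    using d by (auto intro!: derivative_eq_intros)
  moreover have "(\<lambda>z. (ray d z - z) / d) = T"
    using d by (auto simp: ray_def)
  ultimately show False
    using T real_differentiable_def by auto
qed

end

section \<open>The example\<close>

lemma C2_on_imp_twice_differentiable_at:
  assumes "open U" "p \<in> U" "C2_on U u"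
  shows "twice_differentiable_at u p"
proof -
  have "\<forall>\<^sub>F q in nhds p. u differentiable (at q)"
    using eventually_nhds_in_open[OF assms(1,2)]
    by eventually_elim (use assms(3) in \<open>auto simp: C2_on_def\<close>)
  moreover have "(\<lambda>q. \<Sum>i\<in>Basis. partial_deriv i u q *\<^sub>R i) differentiable (at p)"
    using assms(2,3) by (intro differentiable_sum differentiable_scaleR) (auto simp: C2_on_def)
  ultimately show ?thesis
    by (simp add: twice_differentiable_at_def grad_def[abs_def])
qed

lemma antiderivative_exists:
  fixes g :: "real \<Rightarrow> real"
  assumes "continuous_on UNIV g"
  shows "\<exists>f. \<forall>y. (f has_real_derivative g y) (at y)"
  using einterval_antiderivative[of "-\<infinity>" \<infinity> g] assms
  by (auto simp: has_real_derivative_iff_has_vector_derivative continuous_on_eq_continuous_at)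

theorem mainTheorem1:
  shows "\<exists>(f :: real \<Rightarrow> real) (L :: real) (\<delta> :: real).
    C11 f \<and> bdd_above (range (\<lambda>y. \<bar>deriv f y\<bar>)) \<and>
    L > (SUP y. \<bar>deriv f y\<bar>) \<and> \<delta> > 0 \<and>
    infinity_harmonic_on (strip \<delta>) (cone_sup f L) \<and>
    (\<exists>D. D \<subseteq> strip \<delta> \<and> strip \<delta> \<subseteq> closure D \<and>
       (\<forall>p\<in>D. \<not> twice_differentiable_at (cone_sup f L) p \<and>
              \<not> (\<exists>U. open U \<and> p \<in> U \<and> C2_on U (cone_sup f L))))"
proof -
  obtain a :: "nat \<Rightarrow> real" where a: "range a = \<rat>"
    using range_from_nat_into[of "\<rat> :: real set"] countable_rat Rats_0 by blast
  define T where "T y = arctan (corner_sum a y)" for y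
  have lip: "1-lipschitz_on UNIV T"
    unfolding T_def using lipschitz_on_compose2[OF corner_sum_lipschitz arctan_lipschitz] by simp
  let ?g = "\<lambda>y. - sin (arctan (T y))"
  have lipg: "1-lipschitz_on UNIV ?g"
    using lipschitz_on_compose2[OF lipschitz_on_compose2[OF lip arctan_lipschitz] sin_lipschitz]
    by (simp add: lipschitz_on_minus)
  obtain f where f: "\<And>y. (f has_real_derivative ?g y) (at y)"
    using antiderivative_exists lipschitz_on_continuous_on[OF lipg] by metis
  interpret ray_fan T f
    by unfold_locales (fact lip, fact f)
  have df: "deriv f = ?g"
    using f DERIV_imp_deriv by blast
  have "C11 f"
    unfolding C11_def df using f lipg real_differentiable_def by blast
  moreover have bound: "\<bar>deriv f y\<bar> \<le> sin (arctan (pi/2))" for y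
    unfolding df using sin_arctan_mono[of "T y" "pi/2"] sin_arctan_mono[of "- (pi/2)" "T y"]
      arctan_bounded[of "corner_sum a y"] by (auto simp: T_def arctan_minus abs_le_iff)
  then have "bdd_above (range (\<lambda>y. \<bar>deriv f y\<bar>))"
    by (intro bdd_aboveI) auto
  moreover have "(SUP y. \<bar>deriv f y\<bar>) \<le> sin (arctan (pi/2))"
    using bound by (intro cSUP_least) auto
  then have "(SUP y. \<bar>deriv f y\<bar>) < 1"
    using abs_sin_arctan_less_1[of "pi/2"] by linarith
  moreover define D where "D = {(ray d y, d) | d y. y \<in> \<rat> \<and> 0 < d \<and> d < 1}"
  have "D \<subseteq> strip 1"
    by (auto simp: D_def strip_def)
  moreover have "strip 1 \<subseteq> closure D"
  proof
    fix p :: "real \<times> real" assume "p \<in> strip 1"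
    then obtain y d where p: "0 < d" "d < 1" "p = (ray d y, d)" by (rule strip_foot)
    have "(\<lambda>y. (ray d y, d)) ` closure \<rat> \<subseteq> closure ((\<lambda>y. (ray d y, d)) ` \<rat>)"
      using continuous_ray by (intro image_closure_subset closure_subset closed_closure
          continuous_intros continuous_on_subset[OF continuous_ray]) auto
    also have "\<dots> \<subseteq> closure D"
      using p by (intro closure_mono) (auto simp: D_def)
    finally show "p \<in> closure D"
      using p by (auto simp: Rats_closure_real)
  qed
  moreover have "\<not> twice_differentiable_at (cone_sup f 1) p" if pD: "p \<in> D" for p
  proof -
    obtain d y where p: "p = (ray d y, d)" "y \<in> \<rat>" "0 < d" "d < 1"
      using pD by (auto simp: D_def)
    obtain m where m: "y = a m" using p(2) a by blast
    have "\<not> T differentiable (at y)"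
    proof
      assume "T differentiable (at y)"
      then obtain l where l: "(T has_real_derivative l) (at y)"
        by (auto simp: real_differentiable_def)
      have "cos (T y) \<noteq> 0" by (simp add: T_def)
      from DERIV_chain2[OF DERIV_tan[OF this] l]
      have "\<exists>k. ((\<lambda>y. tan (T y)) has_real_derivative k) (at y)" ..
      moreover have "(\<lambda>y. tan (T y)) = corner_sum a"
        by (simp add: T_def tan_arctan fun_eq_iff)
      ultimately show False
        using corner_sum_not_differentiable[of a m] m real_differentiable_def by metis
    qed
    then show ?thesis
      using cone_sup_not_twice_differentiable p by blast
  qed
  then have "\<forall>p\<in>D. \<not> twice_differentiable_at (cone_sup f 1) p \<and>
      \<not> (\<exists>U. open U \<and> p \<in> U \<and> C2_on U (cone_sup f 1))"
    using C2_on_imp_twice_differentiable_at by blast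
  ultimately show ?thesis
    using cone_sup_infinity_harmonic
    by (intro exI[of _ f] exI[of _ 1] exI[of _ D] conjI) simp_all
qed

end
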